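(* Let $M\in ARI^{\Delta}$ be alternal and push-invariant. Let $A=\Delta M$ and let $A'$ be the mould $A'(u_1,\ldots,u_r)=\frac{A(u_1,\ldots,u_r)}{u_1\cdots u_r}=(u_1+\cdots+u_r)M(u_1,\ldots,u_r)$. Then the following are equivalent: (i) $A$ satisfies the strict Fay relations: $\mathcal{F}(A')(u_1,\ldots,u_r)=0$ for all $r\ge2$; (ii) $swapM$ satisfies the first alternality relation: $swapM\bigl(sh((v_1),(v_2,\ldots,v_r))\bigr)=0$ for all $r\ge2$; (iii) $swapM$ satisfies the circ-neutrality relation: $$swapM(v_1,\ldots,v_r)+swapM(v_2,\ldots,v_r,v_1)+\cdots+swapM(v_r,v_1,\ldots,v_{r-1})=0\quad\text{for all } r\ge2.$$
   Context: A mould over $\mathbb{Q}$ is a family $A=(A_r)_{r\ge0}$ where $A_r=A(u_1,\ldots,u_r)$ is a rational function over $\mathbb{Q}$ in $r$ commutative variables ($A(\emptyset)$ a constant). $ARI$ is the space of moulds with $A(\emptyset)=0$. For $r\ge1$, $\Delta A(u_1,\ldots,u_r)=u_1\cdots u_r(u_1+\cdots+u_r)A(u_1,\ldots,u_r)$; $ARI^{\Delta}$ is the subspace of $A\in ARI$ such that all components of $\Delta A$ are polynomials. $A(sh(\cdot,\cdot))$ denotes the sum of $A$ over all shuffles of the two sequences. $A$ is alternal if $A\bigl(sh((u_1,\ldots,u_i),(u_{i+1},\ldots,u_r))\bigr)=0$ for $r\ge2$, $1\le i\le r-1$. $A$ is push-invariant if $A(-u_1-\cdots-u_r,u_1,\ldots,u_{r-1})=A(u_1,\ldots,u_r)$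 for all $r\ge1$. The swap is $swapA(v_1,\ldots,v_r)=A(v_r,v_{r-1}-v_r,\ldots,v_1-v_2)$. The Fay operator is $$\mathcal{F}(B)(u_1,\ldots,u_r)=B(u_1,\ldots,u_r)+B(u_2,\ldots,u_r,-\bar u_r)+\sum_{i=1}^{r-1}B(u_2,\ldots,u_i,-\bar u_i,\bar u_{i+1},u_{i+2},\ldots,u_r),\quad \bar u_i=u_1+\cdots+u_i.$$ *)

theory Defs
  imports "HOL-Library.Poly_Mapping" "HOL-Computational_Algebra.Polynomial_Factorial"
begin

section \<open>Rational functions over the rationals in the variables 1, 2, 3, \ldots\<close>

text \<open>
  A monomial is a finitely supported exponent vector indexed by the variables, and a polynomial
  is a finitely supported family of rational coefficients indexed by the monomials.
\<close>

type_synonym qpoly = "(nat \<Rightarrow>\<^sub>0 nat) \<Rightarrow>\<^sub>0 rat"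
type_synonym ratfun = "qpoly fract"

definition var :: "nat \<Rightarrow> ratfun" where
  "var i = to_fract (Poly_Mapping.single (Poly_Mapping.single i 1) 1)"

definition polys :: "nat \<Rightarrow> qpoly set" where
  "polys r = {p. \<forall>m \<in> Poly_Mapping.keys p. Poly_Mapping.keys m \<subseteq> {1..r}}"

definition ratfuns :: "nat \<Rightarrow> ratfun set" where
  "ratfuns r = {Fract p q | p q. p \<in> polys r \<and> q \<in> polys r \<and> q \<noteq> 0}"

definition eval_poly :: "(nat \<Rightarrow> ratfun) \<Rightarrow> qpoly \<Rightarrow> ratfun" where
  "eval_poly f p = (\<Sum>m \<in> Poly_Mapping.keys p.
     to_fract (Poly_Mapping.single 0 (Poly_Mapping.lookup p m)) *
     (\<Prod>i \<in> Poly_Mapping.keys m. f i ^ Poly_Mapping.lookup m i))"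

text \<open>
  Substitution into a rational function is specified only if the function has a representation
  whose denominator does not vanish under the substitution; the value then does not depend on
  the representation (lemma \<open>subst_Fract\<close> below). This is always the case when the substituted
  functions are algebraically independent, as for the invertible linear changes of variables
  used below.
\<close>

definition subst :: "(nat \<Rightarrow> ratfun) \<Rightarrow> ratfun \<Rightarrow> ratfun" where
  "subst f x = (THE y. \<exists>p q. x = Fract p q \<and> eval_poly f q \<noteq> 0 \<and> y = eval_poly f p / eval_poly f q)"


section \<open>Moulds\<close>

type_synonym mould = "nat \<Rightarrow> ratfun"

definition is_mould :: "mould \<Rightarrow> bool" where
  "is_mould A \<longleftrightarrow> (\<forall>r. A r \<in> ratfuns r)"

text \<open>
  \<open>mould_at A [x\<^sub>1, \<dots>, x\<^sub>r]\<close> is \<open>A(x\<^sub>1, \<dots>, x\<^sub>r)\<close>. Lists are indexed from 0 and variables from 1.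
  In particular \<open>A r\<close> itself is \<open>A(u\<^sub>1, \<dots>, u\<^sub>r)\<close> with \<open>u\<^sub>i = var i\<close> (lemma \<open>mould_at_vars\<close> below).
  The variables \<open>v\<^sub>i\<close> of swapped moulds are also \<open>var i\<close>.
\<close>

definition mould_at :: "mould \<Rightarrow> ratfun list \<Rightarrow> ratfun" where
  "mould_at A xs = subst (\<lambda>i. xs ! (i - 1)) (A (length xs))"

definition vars :: "nat \<Rightarrow> nat \<Rightarrow> ratfun list" where
  "vars i j = map var [i..<Suc j]"  \<comment> \<open>\<open>[u\<^sub>i, \<dots>, u\<^sub>j]\<close>, empty if \<open>j < i\<close>\<close>

definition ubar :: "nat \<Rightarrow> ratfun" where
  "ubar i = (\<Sum>j = 1..i. var j)"

definition ARI :: "mould set" where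
  "ARI = {A. is_mould A \<and> A 0 = 0}"

definition Delta :: "mould \<Rightarrow> mould" where
  "Delta A r = (if r = 0 then A 0 else (\<Prod>j = 1..r. var j) * ubar r * A r)"

definition ARI_Delta :: "mould set" where
  "ARI_Delta = {A \<in> ARI. \<forall>r. Delta A r \<in> to_fract ` polys r}"

definition div_vars :: "mould \<Rightarrow> mould" where
  "div_vars A r = A r / (\<Prod>j = 1..r. var j)"

text \<open>
  All sequences that are shuffled below consist of pairwise distinct variables, so that different
  shuffles give different lists and summing over the set \<open>shuffles xs ys\<close> loses no multiplicities.
\<close>

definition mould_sh :: "mould \<Rightarrow> ratfun list \<Rightarrow> ratfun list \<Rightarrow> ratfun" where
  "mould_sh A xs ys = (\<Sum>w \<in> shuffles xs ys. mould_at A w)"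

definition alternal :: "mould \<Rightarrow> bool" where
  "alternal A \<longleftrightarrow> (\<forall>r \<ge> 2. \<forall>i \<in> {1..r - 1}. mould_sh A (vars 1 i) (vars (i + 1) r) = 0)"

definition push_invariant :: "mould \<Rightarrow> bool" where
  "push_invariant A \<longleftrightarrow> (\<forall>r \<ge> 1. mould_at A (- ubar r # vars 1 (r - 1)) = mould_at A (vars 1 r))"

definition swap :: "mould \<Rightarrow> mould" where
  "swap A r = (if r = 0 then A 0
     else mould_at A (var r # map (\<lambda>j. var j - var (j + 1)) (rev [1..<r])))"

definition Fay :: "mould \<Rightarrow> mould" where
  "Fay B r = mould_at B (vars 1 r) + mould_at B (vars 2 r @ [- ubar r])
     + (\<Sum>i = 1..r - 1. mould_at B (vars 2 i @ [- ubar i, ubar (i + 1)] @ vars (i + 2) r))"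

definition first_alternality :: "mould \<Rightarrow> bool" where
  "first_alternality B \<longleftrightarrow> (\<forall>r \<ge> 2. mould_sh B [var 1] (vars 2 r) = 0)"

definition circ_neutral :: "mould \<Rightarrow> bool" where
  "circ_neutral B \<longleftrightarrow> (\<forall>r \<ge> 2. (\<Sum>k < r. mould_at B (rotate k (vars 1 r))) = 0)"


section \<open>Sanity checks\<close>

lemma poly_mapping_induct [case_names single sum]:
  fixes P :: "('a \<Rightarrow>\<^sub>0 'b::monoid_add) \<Rightarrow> bool"
  assumes single: "\<And>m c. P (Poly_Mapping.single m c)"
    and sum: "\<And>p m c. P p \<Longrightarrow> P (Poly_Mapping.single m c) \<Longrightarrow> P (p + Poly_Mapping.single m c)"
  shows "P p"
proof (induction p rule: update_induct)
  case const
  show ?case using single[of undefined 0] by simp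
next
  case (update f a b)
  have "Poly_Mapping.update a b f = f + Poly_Mapping.single a b"
    using update(1) by (intro poly_mapping_eqI)
      (auto simp: lookup_update lookup_add lookup_single in_keys_iff)
  then show ?case using sum[OF update(3) single] by simp
qed

definition mon :: "(nat \<Rightarrow> ratfun) \<Rightarrow> (nat \<Rightarrow>\<^sub>0 nat) \<Rightarrow> ratfun" where
  "mon f m = (\<Prod>i \<in> Poly_Mapping.keys m. f i ^ Poly_Mapping.lookup m i)"

lemma mon_superset:
  assumes "finite S" "Poly_Mapping.keys m \<subseteq> S"
  shows "mon f m = (\<Prod>i \<in> S. f i ^ Poly_Mapping.lookup m i)"
  unfolding mon_def using assms
  by (intro prod.mono_neutral_left) (auto simp: in_keys_iff)

lemma mon_add: "mon f (m + n) = mon f m * mon f n"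
proof -
  let ?S = "Poly_Mapping.keys m \<union> Poly_Mapping.keys n"
  have "mon f (m + n) = (\<Prod>i \<in> ?S. f i ^ Poly_Mapping.lookup (m + n) i)"
    by (rule mon_superset) (auto simp: Poly_Mapping.keys_add)
  also have "\<dots> = (\<Prod>i \<in> ?S. f i ^ Poly_Mapping.lookup m i) * (\<Prod>i \<in> ?S. f i ^ Poly_Mapping.lookup n i)"
    by (simp add: lookup_add power_add prod.distrib)
  finally show ?thesis
    by (simp add: mon_superset[of ?S m] mon_superset[of ?S n])
qed

lemma eval_poly_superset:
  assumes "finite S" "Poly_Mapping.keys p \<subseteq> S"
  shows "eval_poly f p =
    (\<Sum>m \<in> S. to_fract (Poly_Mapping.single 0 (Poly_Mapping.lookup p m)) * mon f m)"
  unfolding eval_poly_def mon_def[symmetric] using assms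
  by (intro sum.mono_neutral_left) (auto simp: in_keys_iff)

lemma eval_poly_add: "eval_poly f (p + q) = eval_poly f p + eval_poly f q"
proof -
  let ?S = "Poly_Mapping.keys p \<union> Poly_Mapping.keys q"
  have "eval_poly f (p + q) =
      (\<Sum>m \<in> ?S. to_fract (Poly_Mapping.single 0 (Poly_Mapping.lookup (p + q) m)) * mon f m)"
    by (rule eval_poly_superset) (auto simp: Poly_Mapping.keys_add)
  then show ?thesis
    by (simp add: eval_poly_superset[of ?S p] eval_poly_superset[of ?S q] lookup_add single_add
        algebra_simps sum.distrib)
qed

lemma eval_poly_single:
  "eval_poly f (Poly_Mapping.single m c) = to_fract (Poly_Mapping.single 0 c) * mon f m"
  by (simp add: eval_poly_superset[of "{m}"])

lemma eval_poly_mult: "eval_poly f (p * q) = eval_poly f p * eval_poly f q"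
proof -
  have single_times: "eval_poly f (Poly_Mapping.single m c * q) = eval_poly f (Poly_Mapping.single m c) * eval_poly f q"
    for m c q
  proof (induction q rule: poly_mapping_induct)
    case (single n d)
    have "to_fract (Poly_Mapping.single (0::nat \<Rightarrow>\<^sub>0 nat) (c * d)) =
        to_fract (Poly_Mapping.single 0 c) * to_fract (Poly_Mapping.single 0 d)"
      unfolding to_fract_mult[symmetric] by (simp add: mult_single)
    then show ?case
      by (simp add: mult_single eval_poly_single mon_add)
  next
    case (sum p m c)
    then show ?case
      by (simp add: distrib_left eval_poly_add)
  qed
  show ?thesis
  proof (induction p rule: poly_mapping_induct)
    case (single m c)
    show ?case by (rule single_times)
  next
    case (sum p m c)
    then show ?case
      by (simp add: distrib_right eval_poly_add)
  qed
qed

lemma subst_Fract: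
  assumes "eval_poly f q \<noteq> 0"
  shows "subst f (Fract p q) = eval_poly f p / eval_poly f q"
  unfolding subst_def
proof (rule the_equality)
  show "\<exists>p' q'. Fract p q = Fract p' q' \<and> eval_poly f q' \<noteq> 0 \<and>
      eval_poly f p / eval_poly f q = eval_poly f p' / eval_poly f q'"
    using assms by blast
next
  fix y
  assume "\<exists>p' q'. Fract p q = Fract p' q' \<and> eval_poly f q' \<noteq> 0 \<and> y = eval_poly f p' / eval_poly f q'"
  then obtain p' q' where *: "Fract p q = Fract p' q'" "eval_poly f q' \<noteq> 0"
      "y = eval_poly f p' / eval_poly f q'"
    by blast
  have 0: "eval_poly f 0 = 0"
    by (simp add: eval_poly_def)
  have "q \<noteq> 0" "q' \<noteq> 0"
    using 0 assms *(2) by auto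
  then have "p * q' = p' * q"
    using *(1) by (simp add: eq_fract)
  then have "eval_poly f p * eval_poly f q' = eval_poly f p' * eval_poly f q"
    by (metis eval_poly_mult)
  then show "y = eval_poly f p / eval_poly f q"
    using *(2,3) assms by (simp add: frac_eq_eq)
qed

lemma mon_var:
  "mon var m = to_fract (Poly_Mapping.single m (1::rat))"
proof (induction m rule: poly_mapping_induct)
  case (single i n)
  have pow: "to_fract (Poly_Mapping.single (Poly_Mapping.single i 1) (1::rat)) ^ n =
      to_fract (Poly_Mapping.single (Poly_Mapping.single i n) (1::rat))"
  proof (induction n)
    case 0
    then show ?case by (simp flip: to_fract_1)
  next
    case (Suc n)
    then show ?case
      by (simp add: mult_single flip: to_fract_mult single_add)
  qed
  show ?case
    using pow by (simp add: mon_superset[of "{i}"] var_def)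
next
  case (sum p m c)
  then show ?case
    by (simp add: mon_add mult_single flip: to_fract_mult)
qed

lemma eval_poly_var: "eval_poly var p = to_fract p"
proof (induction p rule: poly_mapping_induct)
  case (single m c)
  then show ?case
    by (simp add: eval_poly_single mon_var mult_single flip: to_fract_mult)
next
  case (sum p m c)
  then show ?case
    by (simp add: eval_poly_add)
qed

lemma mould_at_vars:
  assumes "is_mould A"
  shows "mould_at A (vars 1 r) = A r"
proof -
  obtain p q where pq: "A r = Fract p q" "p \<in> polys r" "q \<in> polys r" "q \<noteq> 0"
    using assms unfolding is_mould_def ratfuns_def by blast
  have cong: "eval_poly (\<lambda>i. vars 1 r ! (i - 1)) p = to_fract p" if "p \<in> polys r" for p
  proof -
    have "eval_poly (\<lambda>i. vars 1 r ! (i - 1)) p = eval_poly var p"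
      unfolding eval_poly_def
    proof (intro sum.cong prod.cong arg_cong2[where f = "(*)"] refl)
      fix m i
      assume "m \<in> Poly_Mapping.keys p" "i \<in> Poly_Mapping.keys m"
      then have "1 \<le> i \<and> i \<le> r"
        using that unfolding polys_def by fastforce
      then have "1 + (i - 1) = i" "i - 1 < r" by linarith+
      then have "[1..<Suc r] ! (i - 1) = i" "i - 1 < length [1..<Suc r]"
        using nth_upt[of 1 "i - 1" "Suc r"] by (simp_all del: upt_Suc)
      then have "vars 1 r ! (i - 1) = var i"
        unfolding vars_def by (metis nth_map)
      then show "(vars 1 r ! (i - 1)) ^ Poly_Mapping.lookup m i = var i ^ Poly_Mapping.lookup m i"
        by simp
    qed
    then show ?thesis
      by (simp add: eval_poly_var)
  qed
  have "mould_at A (vars 1 r) = subst (\<lambda>i. vars 1 r ! (i - 1)) (Fract p q)"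
    by (simp add: mould_at_def pq(1)) (simp add: vars_def pq(1) del: upt_Suc)
  also have "\<dots> = to_fract p / to_fract q"
    using pq(4) by (simp add: subst_Fract cong[OF pq(2)] cong[OF pq(3)] del: One_nat_def)
  finally show ?thesis
    by (simp add: pq(1) Fract_conv_to_fract)
qed

lemma div_vars_Delta:
  assumes "r \<ge> 1"
  shows "div_vars (Delta M) r = ubar r * M r"
proof -
  have "var j \<noteq> 0" for j
  proof -
    have "Poly_Mapping.single (Poly_Mapping.single j 1) (1::rat) \<noteq> 0"
      by (metis lookup_single_eq lookup_zero zero_neq_one)
    then show ?thesis
      unfolding var_def by (metis to_fract_eq_0_iff)
  qed
  then have "(\<Prod>j = 1..r. var j) \<noteq> 0"
    by simp
  then show ?thesis
    using assms by (simp add: div_vars_def Delta_def)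
qed

end

(*
  The three relations are equivalent separately at each depth r. In terms of u_i = c_i - c_(i-1),
  push-invariance says that the translation-invariant function f(c_0, ..., c_r) = M(u_1, ..., u_r)
  is invariant under rotating the c_i, while swap M (v_1, ..., v_r) = f(0, v_r, ..., v_1). Hence

  - the first alternality relation says that the sum of f over all insertions of v_1 into the
    cyclic word (v_0, v_2, ..., v_r) vanishes;
  - circ-neutrality says the same with v_0 inserted into (v_1, ..., v_r), that is, with v_0 and
    v_1 exchanged;
  - with c_0 = 0, c_1 = -u_1 and c_k = u_2 + ... + u_k, every term of the Fay operator applied to
    (u_1 + ... + u_r) M is a difference of two c_i times the value of f at an insertion of c_1
    into (c_0, c_2, ..., c_r). The first two terms are rotations of each other, their factors
    c_r - c_1 and c_1 - c_0 add up to c_r - c_0, and this is the factor of all other terms.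

  All changes of variables involved are invertible, so they act as field endomorphisms.
*)
theory Submission
  imports Defs
begin

section \<open>Endomorphisms of the field of rational functions\<close>

text \<open>With \<open>c = 1\<close> the third axiom gives \<open>h 1 = 1\<close>, so
  \<open>h\<close> is a unital endomorphism of a field: it is injective, respects division, and an
  equation holds iff its image does.\<close>

locale ratfun_hom =
  fixes h :: "ratfun \<Rightarrow> ratfun"
  assumes add: "h (x + y) = h x + h y"
    and mult: "h (x * y) = h x * h y"
    and const: "h (to_fract (Poly_Mapping.single 0 c)) = to_fract (Poly_Mapping.single 0 c)"
begin

lemma zero [simp]: "h 0 = 0"
proof -
  have "h 0 + h 0 = h 0 + 0"
    using add[of 0 0] by simp
  then show ?thesis by (rule add_left_imp_eq)
qed

lemma one [simp]: "h 1 = 1"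
  using const[of 1] by simp

lemma minus: "h (- x) = - h x"
  using add[of x "- x"] by (simp add: eq_neg_iff_add_eq_0 add.commute)

lemma diff: "h (x - y) = h x - h y"
  using add[of x "- y"] by (simp add: minus)

lemma sum: "h (sum f S) = (\<Sum>i\<in>S. h (f i))"
  by (induction S rule: infinite_finite_induct) (simp_all add: add)

lemma prod: "h (prod f S) = (\<Prod>i\<in>S. h (f i))"
  by (induction S rule: infinite_finite_induct) (simp_all add: mult)

lemma power: "h (x ^ n) = h x ^ n"
  by (induction n) (simp_all add: mult)

lemma eq_0_iff [simp]: "h x = 0 \<longleftrightarrow> x = 0"
proof
  assume "h x = 0"
  \<comment> \<open>A nonzero \<open>x\<close> is invertible, so this would force
    \<open>h 1 = 0\<close>.\<close>
  then have "h (x * inverse x) = 0"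
    by (simp only: mult) simp
  then show "x = 0"
    by (cases "x = 0") simp_all
qed simp

lemma eq_iff: "h x = h y \<longleftrightarrow> x = y"
  using eq_0_iff[of "x - y"] by (simp add: diff)

lemma divide: "h (x / y) = h x / h y"
proof (cases "y = 0")
  case False
  then have "h (x / y) * h y = h x"
    by (simp flip: mult)
  then show ?thesis
    using False by (simp add: nonzero_eq_divide_eq)
qed simp

lemma sum_list: "h (sum_list xs) = sum_list (map h xs)"
  by (induction xs) (simp_all add: add)

lemma mon: "h (mon f m) = mon (\<lambda>i. h (f i)) m"
  by (simp add: mon_def prod power)

text \<open>Coefficients are fixed, so with \<open>f = var\<close> this determines \<open>h\<close>
  on polynomials by its values on the variables.\<close>

lemma eval_poly: "h (eval_poly f p) = eval_poly (\<lambda>i. h (f i)) p"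
  by (induction p rule: poly_mapping_induct) (simp_all add: eval_poly_single eval_poly_add mult add const mon)

end

lemma ratfun_hom_comp:
  assumes "ratfun_hom h" "ratfun_hom k"
  shows "ratfun_hom (\<lambda>x. h (k x))"
  using assms unfolding ratfun_hom_def by auto

definition qvar :: "nat \<Rightarrow> qpoly" where
  "qvar i = Poly_Mapping.single (Poly_Mapping.single i 1) 1"

lemma to_fract_qvar: "to_fract (qvar i) = var i"
  by (simp add: qvar_def var_def)

lemma eval_poly_0: "eval_poly f 0 = 0"
  by (simp add: eval_poly_def)

lemma eval_poly_const:
  "eval_poly f (Poly_Mapping.single 0 c) = to_fract (Poly_Mapping.single 0 c)"
  by (simp add: eval_poly_single mon_def)

lemma eval_poly_1: "eval_poly f 1 = 1"
  using eval_poly_const[of f 1] by simp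

lemma eval_poly_qvar: "eval_poly f (qvar i) = f i"
  by (simp add: qvar_def eval_poly_single mon_superset[of "{i}"])

lemma eval_poly_diff: "eval_poly f (p - q) = eval_poly f p - eval_poly f q"
  using eval_poly_add[of f "p - q" q] by simp

lemma eval_poly_sum: "eval_poly f (sum P S) = (\<Sum>i\<in>S. eval_poly f (P i))"
  by (induction S rule: infinite_finite_induct) (simp_all add: eval_poly_0 eval_poly_add)

lemma var_eq_iff: "var i = var j \<longleftrightarrow> i = j"
proof
  assume "var i = var j"
  then have "qvar i = qvar j"
    by (simp flip: to_fract_qvar)
  from arg_cong[OF this, of Poly_Mapping.keys] show "i = j"
    by (auto simp: qvar_def dest: arg_cong[of _ _ Poly_Mapping.keys])
qed simp

text \<open>Since nonzero denominators stay nonzero, any representation as a fraction may be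
  evaluated by \<open>subst_Fract\<close>.\<close>

lemma ratfun_hom_subst:
  assumes nz: "\<And>q. q \<noteq> 0 \<Longrightarrow> eval_poly g q \<noteq> 0"
  shows "ratfun_hom (subst g)"
proof
  fix x y :: ratfun
  obtain p q where x: "x = Fract p q" "q \<noteq> 0"
    by (cases x) auto
  obtain p' q' where y: "y = Fract p' q'" "q' \<noteq> 0"
    by (cases y) auto
  note nz = nz[OF x(2)] nz[OF y(2)] nz[of "q * q'"]
  show "subst g (x + y) = subst g x + subst g y"
    using nz x(2) y(2)
    by (simp add: x(1) y(1) subst_Fract eval_poly_add eval_poly_mult add_frac_eq)
  show "subst g (x * y) = subst g x * subst g y"
    using nz x(2) y(2) by (simp add: x(1) y(1) subst_Fract eval_poly_mult)
next
  fix c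
  show "subst g (to_fract (Poly_Mapping.single 0 c)) = to_fract (Poly_Mapping.single 0 c)"
    unfolding to_fract_def[of "Poly_Mapping.single 0 c"]
    by (simp add: subst_Fract eval_poly_1 eval_poly_const) (simp add: to_fract_def)
qed

lemma subst_var: "subst g (var i) = g i"
  by (simp add: to_fract_def subst_Fract eval_poly_1 eval_poly_qvar flip: to_fract_qvar)

text \<open>Substitutions compose. The polynomial \<open>q\<close> appears because
  \<open>eval_poly\<close> returns a rational function, which cannot be evaluated a second time
  directly.\<close>

lemma eval_poly_to_fract: "\<exists>q. eval_poly (\<lambda>i. to_fract (P i)) p = to_fract q \<and>
  eval_poly f q = eval_poly (\<lambda>i. eval_poly f (P i)) p"
proof (induction p rule: poly_mapping_induct)
  case (single m c)
  have pow: "eval_poly f (a ^ n) = eval_poly f a ^ n" for a n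
    by (induction n) (simp_all add: eval_poly_1 eval_poly_mult)
  have prod: "eval_poly f (\<Prod>i\<in>S. Q i) = (\<Prod>i\<in>S. eval_poly f (Q i))" for Q and S :: "nat set"
    by (induction S rule: infinite_finite_induct) (simp_all add: eval_poly_1 eval_poly_mult)
  have pow': "to_fract a ^ n = to_fract (a ^ n)" for a :: qpoly and n
    by (induction n) simp_all
  have prod': "(\<Prod>i\<in>S. to_fract (Q i)) = to_fract (\<Prod>i\<in>S. Q i)" for Q :: "nat \<Rightarrow> qpoly" and S
    by (induction S rule: infinite_finite_induct) simp_all
  show ?case
    by (intro exI[of _ "Poly_Mapping.single 0 c *
        (\<Prod>i\<in>Poly_Mapping.keys m. P i ^ Poly_Mapping.lookup m i)"])
      (simp add: eval_poly_single mon_def eval_poly_mult prod pow pow' prod' eval_poly_const)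
next
  case (sum p m c)
  then show ?case
    by (metis eval_poly_add to_fract_add)
qed

text \<open>A left inverse makes the substitution injective on polynomials, so no denominator vanishes.\<close>

lemma ratfun_hom_left_inverse:
  assumes "\<And>i. eval_poly g' (P i) = var i"
  obtains h where "ratfun_hom h" "\<And>i. h (var i) = to_fract (P i)"
proof
  show "ratfun_hom (subst (\<lambda>i. to_fract (P i)))"
  proof (rule ratfun_hom_subst)
    fix p :: qpoly
    assume "p \<noteq> 0"
    obtain q where q: "eval_poly (\<lambda>i. to_fract (P i)) p = to_fract q"
        "eval_poly g' q = eval_poly (\<lambda>i. eval_poly g' (P i)) p"
      using eval_poly_to_fract by blast
    \<comment> \<open>Evaluating again, at \<open>g'\<close>, recovers \<open>p\<close>, so the
      first evaluation cannot vanish.\<close>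
    then have "eval_poly g' q = to_fract p"
      by (simp add: assms eval_poly_var)
    then have "q \<noteq> 0"
      using \<open>p \<noteq> 0\<close> by (auto simp: eval_poly_0)
    then show "eval_poly (\<lambda>i. to_fract (P i)) p \<noteq> 0"
      by (simp add: q(1))
  qed
qed (rule subst_var)

section \<open>Changes of variables with an explicit left inverse\<close>

lemma ratfun_hom_rename:
  assumes "inj \<pi>"
  obtains h where "ratfun_hom h" "\<And>i. h (var i) = var (\<pi> i)"
proof (rule ratfun_hom_left_inverse)
  show "eval_poly (\<lambda>i. var (inv \<pi> i)) (qvar (\<pi> i)) = var i" for i
    using assms by (simp add: eval_poly_qvar)
qed (simp add: to_fract_qvar)

text \<open>Serves to normalise \<open>c_0 = 0\<close> for the swap. Sending \<open>var 0\<close>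
  itself to 0 would not be injective, so all other variables are translated instead.\<close>

lemma ratfun_hom_shift:
  obtains h where "ratfun_hom h" "h (var 0) = var 0" "\<And>i. i \<noteq> 0 \<Longrightarrow> h (var i) = var i + var 0"
proof (rule ratfun_hom_left_inverse)
  show "eval_poly (\<lambda>i. if i = 0 then var 0 else var i - var 0)
      (if i = 0 then qvar 0 else qvar i + qvar 0) = var i" for i
    by (simp add: eval_poly_qvar eval_poly_add)
qed (simp add: to_fract_qvar)

text \<open>Consecutive images differ by a single variable, so differences of the \<open>c_i\<close>
  become the \<open>u_i\<close>; \<open>ratfun_hom_difference\<close> goes the other way.\<close>

lemma ratfun_hom_partial_sum:
  obtains h where "ratfun_hom h" "\<And>i. h (var i) = (\<Sum>j\<le>i. var j)"
proof (rule ratfun_hom_left_inverse)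
  have *: "(\<Sum>j\<le>i. if j = 0 then var 0 else var j - var (j - 1)) = var i" for i
    by (induction i) simp_all
  show "eval_poly (\<lambda>i. if i = 0 then var 0 else var i - var (i - 1)) (\<Sum>j\<le>i. qvar j) = var i" for i
    by (simp add: eval_poly_qvar eval_poly_sum *)
qed (simp add: to_fract_qvar to_fract_sum)

lemma ratfun_hom_difference:
  obtains h where "ratfun_hom h" "\<And>i. h (var (Suc i)) = var (Suc i) - var i"
proof (rule ratfun_hom_left_inverse)
  show "eval_poly (\<lambda>i. \<Sum>j\<le>i. var j) (case i of 0 \<Rightarrow> qvar 0 | Suc j \<Rightarrow> qvar i - qvar j) = var i" for i
    by (cases i) (simp_all add: eval_poly_qvar eval_poly_diff)
qed (simp add: to_fract_qvar)

text \<open>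
  Under this change of variables the argument lists of the Fay operator become the consecutive
  differences of \<open>0, 2, \<dots>, r\<close> with 1 inserted somewhere; see \<open>Fay_iff\<close>.
\<close>

lemma ratfun_hom_Fay:
  obtains h where "ratfun_hom h" "h (var 0) = var 0" "h (var 1) = var 0 - var 1"
    "\<And>i. i \<ge> 2 \<Longrightarrow> h (var i) = var 0 + (\<Sum>j = 2..i. var j)"
proof (rule ratfun_hom_left_inverse)
  \<comment> \<open>In the chain 0, 2, 3, ... the predecessor of 2 is 0, hence the separate
    case.\<close>
  let ?g = "\<lambda>i. if i = 0 then var 0 else if i = 1 then var 0 - var 1
    else if i = 2 then var 2 - var 0 else var i - var (i - 1)"
  have *: "(\<Sum>j = 2..i. ?g j) = var i - var 0" if "i \<ge> 2" for i
    using that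
  proof (induction i rule: dec_induct)
    case (step i)
    then have "(\<Sum>j = 2..Suc i. ?g j) = (\<Sum>j = 2..i. ?g j) + ?g (Suc i)"
      by (simp only: sum.nat_ivl_Suc' add.commute)
    then show ?case
      using step by simp
  qed simp
  show "eval_poly ?g
      (if i = 0 then qvar 0 else if i = 1 then qvar 0 - qvar 1 else qvar 0 + (\<Sum>j = 2..i. qvar j)) = var i"
    for i
  proof (cases "i \<ge> 2")
    case True
    have "(\<Sum>j = 2..i. eval_poly ?g (qvar j)) = var i - var 0"
      using *[OF True] by (simp only: eval_poly_qvar)
    then show ?thesis
      using True by (simp add: eval_poly_add eval_poly_sum) (simp add: eval_poly_qvar)
  next
    case False
    then have "i = 0 \<or> i = 1" by auto
    then show ?thesis by (auto simp: eval_poly_qvar eval_poly_diff)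
  qed
qed (simp_all add: to_fract_qvar to_fract_sum)


section \<open>Evaluation of moulds\<close>

lemma zero_polys: "0 \<in> polys r"
  by (simp add: polys_def)

lemma const_polys: "Poly_Mapping.single 0 c \<in> polys r"
  by (auto simp: polys_def)

lemma one_polys: "1 \<in> polys r"
  using const_polys[of 1] by simp

lemma add_polys: "p \<in> polys r \<Longrightarrow> q \<in> polys r \<Longrightarrow> p + q \<in> polys r"
  using Poly_Mapping.keys_add[of p q] by (auto simp: polys_def)

lemma uminus_polys: "p \<in> polys r \<Longrightarrow> - p \<in> polys r"
  by (simp add: polys_def)

lemma mult_polys:
  assumes "p \<in> polys r" "q \<in> polys r"
  shows "p * q \<in> polys r"
  unfolding polys_def
proof (intro CollectI ballI)
  fix m assume "m \<in> Poly_Mapping.keys (p * q)"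
  then obtain a b where "m = a + b" "a \<in> Poly_Mapping.keys p" "b \<in> Poly_Mapping.keys q"
    using keys_mult[of p q] by blast
  then show "Poly_Mapping.keys m \<subseteq> {1..r}"
    using assms Poly_Mapping.keys_add[of a b] unfolding polys_def by blast
qed

lemma ratfunsI: "p \<in> polys r \<Longrightarrow> q \<in> polys r \<Longrightarrow> q \<noteq> 0 \<Longrightarrow> Fract p q \<in> ratfuns r"
  by (auto simp: ratfuns_def)

lemma ratfunsE:
  assumes "x \<in> ratfuns r"
  obtains p q where "p \<in> polys r" "q \<in> polys r" "q \<noteq> 0" "x = Fract p q"
  using assms by (auto simp: ratfuns_def)

lemma to_fract_ratfuns: "p \<in> polys r \<Longrightarrow> to_fract p \<in> ratfuns r"
  by (simp add: to_fract_def ratfunsI one_polys)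

lemma add_ratfuns:
  assumes "x \<in> ratfuns r" "y \<in> ratfuns r"
  shows "x + y \<in> ratfuns r"
  using assms by (elim ratfunsE) (simp add: ratfunsI add_polys mult_polys)

lemma mult_ratfuns:
  assumes "x \<in> ratfuns r" "y \<in> ratfuns r"
  shows "x * y \<in> ratfuns r"
  using assms by (elim ratfunsE) (simp add: ratfunsI mult_polys)

lemma diff_ratfuns:
  assumes "x \<in> ratfuns r" "y \<in> ratfuns r"
  shows "x - y \<in> ratfuns r"
proof -
  have "- y \<in> ratfuns r"
    using assms(2) by (elim ratfunsE) (simp add: ratfunsI uminus_polys)
  then show ?thesis
    using add_ratfuns[OF assms(1)] by fastforce
qed

lemma divide_ratfuns:
  assumes "x \<in> ratfuns r" "y \<in> ratfuns r"
  shows "x / y \<in> ratfuns r"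
proof (cases "y = 0")
  \<comment> \<open>Division by zero yields 0, which lies in every \<open>ratfuns r\<close>.\<close>
  case True
  then show ?thesis using to_fract_ratfuns[OF zero_polys] by simp
next
  case False
  with assms show ?thesis
    by (elim ratfunsE) (auto simp: Zero_fract_def eq_fract intro!: ratfunsI mult_polys)
qed

lemma sum_ratfuns: "(\<And>i. i \<in> S \<Longrightarrow> f i \<in> ratfuns r) \<Longrightarrow> sum f S \<in> ratfuns r"
  using to_fract_ratfuns[OF zero_polys, of r]
  by (induction S rule: infinite_finite_induct) (simp_all add: add_ratfuns)

lemma prod_ratfuns: "(\<And>i. i \<in> S \<Longrightarrow> f i \<in> ratfuns r) \<Longrightarrow> prod f S \<in> ratfuns r"
  using to_fract_ratfuns[OF one_polys, of r]
  by (induction S rule: infinite_finite_induct) (simp_all add: mult_ratfuns)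

lemma power_ratfuns: "x \<in> ratfuns r \<Longrightarrow> x ^ n \<in> ratfuns r"
  using to_fract_ratfuns[OF one_polys, of r]
  by (induction n) (simp_all add: mult_ratfuns)

lemma var_ratfuns: "i \<in> {1..r} \<Longrightarrow> var i \<in> ratfuns r"
  unfolding var_def by (intro to_fract_ratfuns) (auto simp: polys_def)

lemma eval_poly_ratfuns:
  assumes "p \<in> polys r" "\<And>i. i \<in> {1..r} \<Longrightarrow> f i \<in> ratfuns s"
  shows "eval_poly f p \<in> ratfuns s"
  unfolding eval_poly_def
proof (intro sum_ratfuns mult_ratfuns prod_ratfuns power_ratfuns to_fract_ratfuns const_polys assms(2))
  show "i \<in> {1..r}" if "m \<in> Poly_Mapping.keys p" "i \<in> Poly_Mapping.keys m" for m i
    using that assms(1) unfolding polys_def by blast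
qed

lemma eval_poly_cong:
  assumes "p \<in> polys r" "\<And>i. i \<in> {1..r} \<Longrightarrow> f i = g i"
  shows "eval_poly f p = eval_poly g p"
  unfolding eval_poly_def
proof (intro sum.cong prod.cong arg_cong2[where f = "(*)"] refl)
  fix m i
  assume "m \<in> Poly_Mapping.keys p" "i \<in> Poly_Mapping.keys m"
  then have "i \<in> {1..r}"
    using assms(1) unfolding polys_def by blast
  then show "f i ^ Poly_Mapping.lookup m i = g i ^ Poly_Mapping.lookup m i"
    by (simp add: assms(2))
qed

lemma length_vars [simp]: "length (vars i j) = Suc j - i"
  by (simp add: vars_def del: upt_Suc)

text \<open>Such entries are algebraically independent because \<open>h\<close> is injective, so
  substituting them makes no nonzero denominator vanish.\<close>

definition generic :: "ratfun list \<Rightarrow> bool" where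
  "generic xs \<longleftrightarrow> (\<exists>h. ratfun_hom h \<and> xs = map h (vars 1 (length xs)))"

lemma generic_map:
  assumes "generic xs" "ratfun_hom h"
  shows "generic (map h xs)"
proof -
  obtain k where k: "ratfun_hom k" "xs = map k (vars 1 (length xs))"
    using assms(1) unfolding generic_def by blast
  have "map h xs = map (\<lambda>x. h (k x)) (vars 1 (length xs))"
    by (subst k(2)) simp
  then show ?thesis
    unfolding generic_def using ratfun_hom_comp[OF assms(2) k(1)] by auto
qed

text \<open>Genericity keeps the denominator nonzero. The first form shows in which variables the
  value lies; by the second, any \<open>h\<close> producing the list computes the value, as only its
  action on the variables 1 to \<open>length xs\<close> matters.\<close>

lemma mould_at_Fract:
  assumes "generic xs" "A (length xs) = Fract p q" "p \<in> polys (length xs)" "q \<in> polys (length xs)" "q \<noteq> 0"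
  shows "mould_at A xs = eval_poly (\<lambda>i. xs ! (i - 1)) p / eval_poly (\<lambda>i. xs ! (i - 1)) q"
    and "ratfun_hom h \<Longrightarrow> xs = map h (vars 1 (length xs)) \<Longrightarrow> mould_at A xs = h (A (length xs))"
proof -
  have *: "eval_poly (\<lambda>i. xs ! (i - 1)) p = h (to_fract p)"
    if "ratfun_hom h" "xs = map h (vars 1 (length xs))" "p \<in> polys (length xs)" for h p
  proof -
    interpret ratfun_hom h by fact
    have "eval_poly (\<lambda>i. xs ! (i - 1)) p = eval_poly (\<lambda>i. h (var i)) p"
    proof (rule eval_poly_cong[OF that(3)])
      fix i assume "i \<in> {1..length xs}"
      then obtain j where i: "i = Suc j" "j < length xs"
        by (cases i) auto
      have "xs ! (i - 1) = map h (vars 1 (length xs)) ! (i - 1)"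
        using that(2) by simp
      also have "\<dots> = h (var i)"
        using i by (simp add: vars_def del: upt_Suc)
      finally show "xs ! (i - 1) = h (var i)" .
    qed
    also have "\<dots> = h (to_fract p)"
      by (simp flip: eval_poly eval_poly_var)
    finally show ?thesis .
  qed
  obtain k where k: "ratfun_hom k" "xs = map k (vars 1 (length xs))"
    using assms(1) unfolding generic_def by blast
  interpret k: ratfun_hom k by fact
  have "eval_poly (\<lambda>i. xs ! (i - 1)) q \<noteq> 0"
    using assms(5) *[OF k assms(4)] by simp
  then show eq: "mould_at A xs = eval_poly (\<lambda>i. xs ! (i - 1)) p / eval_poly (\<lambda>i. xs ! (i - 1)) q"
    unfolding mould_at_def assms(2) by (rule subst_Fract)
  assume h: "ratfun_hom h" "xs = map h (vars 1 (length xs))"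
  interpret ratfun_hom h by fact
  show "mould_at A xs = h (A (length xs))"
    unfolding eq *[OF h assms(3)] *[OF h assms(4)] assms(2)
    by (simp add: Fract_conv_to_fract divide)
qed

lemma mould_at_hom_vars:
  assumes "A r \<in> ratfuns r" "ratfun_hom h"
  shows "mould_at A (map h (vars 1 r)) = h (A r)"
proof -
  obtain p q where "p \<in> polys r" "q \<in> polys r" "q \<noteq> 0" "A r = Fract p q"
    using assms(1) by (rule ratfunsE)
  then show ?thesis
    using mould_at_Fract(2)[of "map h (vars 1 r)" A p q h] assms(2) by (auto simp: generic_def)
qed

text \<open>If \<open>xs\<close> is the image of the variables under \<open>k\<close>, both sides
  are \<open>h\<close> after \<open>k\<close> applied to the component of \<open>A\<close>.\<close>

lemma mould_at_hom:
  assumes "generic xs" "A (length xs) \<in> ratfuns (length xs)" "ratfun_hom h"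
  shows "mould_at A (map h xs) = h (mould_at A xs)"
proof -
  obtain k where k: "ratfun_hom k" "xs = map k (vars 1 (length xs))"
    using assms(1) unfolding generic_def by blast
  have "mould_at A (map h xs) = mould_at A (map (\<lambda>x. h (k x)) (vars 1 (length xs)))"
    by (subst k(2)) (simp add: comp_def)
  also have "\<dots> = h (k (A (length xs)))"
    by (rule mould_at_hom_vars[where A = A and h = "\<lambda>x. h (k x)", OF assms(2) ratfun_hom_comp[OF assms(3) k(1)]])
  also have "\<dots> = h (mould_at A xs)"
    using mould_at_hom_vars[where A = A and r = "length xs", OF assms(2) k(1)] k(2) by simp
  finally show ?thesis .
qed

text \<open>Used to see that a component of the swap is again a rational function in the first
  \<open>r\<close> variables.\<close>

lemma mould_at_ratfuns:
  assumes "generic xs" "A (length xs) \<in> ratfuns (length xs)" "set xs \<subseteq> ratfuns s"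
  shows "mould_at A xs \<in> ratfuns s"
proof -
  obtain p q where pq: "p \<in> polys (length xs)" "q \<in> polys (length xs)" "q \<noteq> 0" "A (length xs) = Fract p q"
    using assms(2) by (rule ratfunsE)
  have "xs ! (i - 1) \<in> ratfuns s" if "i \<in> {1..length xs}" for i
    using that assms(3) nth_mem[of "i - 1" xs] by fastforce
  then show ?thesis
    unfolding mould_at_Fract(1)[where A = A, OF assms(1) pq(4,1-3)]
    using pq by (intro divide_ratfuns eval_poly_ratfuns[of _ "length xs"]) auto
qed


section \<open>Differences of cyclic sequences\<close>

fun differences :: "ratfun list \<Rightarrow> ratfun list" where
  "differences (x # y # xs) = (y - x) # differences (y # xs)"
| "differences xs = []"

lemma length_differences [simp]: "length (differences xs) = length xs - 1"
  by (induction xs rule: differences.induct) simp_all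

lemma nth_differences: "Suc i < length xs \<Longrightarrow> differences xs ! i = xs ! Suc i - xs ! i"
  by (induction xs arbitrary: i rule: differences.induct) (auto simp: nth_Cons split: nat.split)

lemma differences_hom: "ratfun_hom h \<Longrightarrow> differences (map h xs) = map h (differences xs)"
  by (induction xs rule: differences.induct) (simp_all add: ratfun_hom.diff)

lemma differences_shift: "differences (map (\<lambda>x. x + a) xs) = differences xs"
  by (induction xs rule: differences.induct) simp_all

lemma differences_append:
  "differences (xs @ x # ys) = differences (xs @ [x]) @ differences (x # ys)"
  by (induction xs rule: differences.induct) simp_all

lemma sum_list_differences: "xs \<noteq> [] \<Longrightarrow> sum_list (differences xs) = last xs - hd xs"
  by (induction xs rule: differences.induct) simp_all

lemma set_differences:
  "set xs \<subseteq> ratfuns r \<Longrightarrow> set (differences xs) \<subseteq> ratfuns r"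
  by (induction xs rule: differences.induct) (simp_all add: diff_ratfuns)

section \<open>Genericity of lists of differences and of lists of variables\<close>

lemma extend_inj:
  fixes c :: "nat list"
  assumes "distinct c"
  obtains \<pi> where "inj \<pi>" "c = map \<pi> [0..<length c]"
proof
  \<comment> \<open>Every entry of \<open>c\<close> is at most \<open>sum_list c\<close>, so the
    values beyond the list are new. A map on all indices is needed to define an
    endomorphism.\<close>
  let ?\<pi> = "\<lambda>i. if i < length c then c ! i else Suc (sum_list c) + i"
  have le: "c ! i \<le> sum_list c" if "i < length c" for i
    using that by (simp add: member_le_sum_list)
  show "inj ?\<pi>"
  proof (rule injI)
    fix i j
    assume "?\<pi> i = ?\<pi> j"
    then show "i = j"
      using le[of i] le[of j] assms by (auto simp: nth_eq_iff_index_eq split: if_splits)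
  qed
  show "c = map ?\<pi> [0..<length c]"
    by (rule nth_equalityI) simp_all
qed

text \<open>Renaming reduces this to \<open>c = [0..<Suc r]\<close>, whose differences are the
  images of the variables under \<open>ratfun_hom_difference\<close>.\<close>

lemma generic_differences:
  assumes "distinct c" "c \<noteq> []"
  shows "generic (differences (map var c))"
proof -
  obtain r where r: "length c = Suc r"
    using assms(2) by (cases c) auto
  obtain \<pi> where \<pi>: "inj \<pi>" "c = map \<pi> [0..<length c]"
    using assms(1) by (rule extend_inj)
  obtain h where h: "ratfun_hom h" "\<And>i. h (var i) = var (\<pi> i)"
    using ratfun_hom_rename[OF \<pi>(1)] by blast
  obtain k where k: "ratfun_hom k" "\<And>i. k (var (Suc i)) = var (Suc i) - var i"
    by (rule ratfun_hom_difference) blast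
  have "differences (map var [0..<Suc r]) = map k (vars 1 r)"
    by (rule nth_equalityI) (simp_all add: nth_differences vars_def k(2) del: upt_Suc)
  then have "generic (differences (map var [0..<Suc r]))"
    using k(1) unfolding generic_def by auto
  moreover have "differences (map var c) = map h (differences (map var [0..<Suc r]))"
    by (subst \<pi>(2)) (simp add: h r comp_def del: upt_Suc flip: differences_hom)
  ultimately show ?thesis
    by (simp add: generic_map[OF _ h(1)])
qed

lemma generic_vars:
  assumes "distinct c" "0 \<notin> set c"
  shows "generic (map var c)"
proof -
  \<comment> \<open>Prepending 0 aligns \<open>extend_inj\<close>, which numbers from 0, with mould
    variables, which start at 1.\<close>
  obtain \<pi> where \<pi>: "inj \<pi>" "0 # c = map \<pi> [0..<length (0 # c)]"
    using assms by (metis distinct.simps(2) extend_inj)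
  obtain h where h: "ratfun_hom h" "\<And>i. h (var i) = var (\<pi> i)"
    using ratfun_hom_rename[OF \<pi>(1)] by blast
  have "c = map \<pi> [1..<Suc (length c)]"
    using \<pi>(2) by (simp add: upt_rec[of 0] del: upt_Suc)
  from arg_cong[OF this, of "map var"] have "map var c = map h (vars 1 (length (map var c)))"
    by (simp add: vars_def h(2) comp_def del: upt_Suc)
  then show ?thesis
    using h(1) unfolding generic_def by blast
qed

lemma shuffles_singleton: "shuffles [x] ys = (\<lambda>i. take i ys @ x # drop i ys) ` {..length ys}"
proof (induction ys)
  case (Cons y ys)
  have "{..length (y # ys)} = insert 0 (Suc ` {..length ys})"
    by (simp add: atMost_Suc_eq_insert_0)
  then show ?case
    by (simp add: Cons.IH image_image)
qed simp

text \<open>Partial sums send \<open>var i\<close> to \<open>var 0 + ubar i\<close>. Moving the last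
  entry to the front creates the first difference \<open>var 0 - var r\<close>, whose image is
  \<open>- ubar r\<close>.\<close>

lemma push_arguments_eq_differences:
  fixes r :: nat
  assumes "r \<ge> 1"
  obtains h where "ratfun_hom h"
    "vars 1 r = map h (differences (map var [0..<Suc r]))"
    "- ubar r # vars 1 (r - 1) = map h (differences (map var (r # [0..<r])))"
proof -
  obtain h where h: "ratfun_hom h" "\<And>i. h (var i) = (\<Sum>j\<le>i. var j)"
    by (rule ratfun_hom_partial_sum) blast
  interpret ratfun_hom h by fact
  have *: "vars 1 s = map h (differences (map var [0..<Suc s]))" for s
    by (rule nth_equalityI) (simp_all add: nth_differences vars_def diff h(2) del: upt_Suc)
  obtain s where s: "r = Suc s"
    using assms by (cases r) auto
  have "(\<Sum>j\<le>r. var j) = var 0 + ubar r"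
    by (simp add: ubar_def atMost_atLeast0 sum.atLeast_Suc_atMost)
  then have "- ubar r = h (var 0 - var r)"
    by (simp add: diff h(2))
  moreover have "differences (map var (r # [0..<r])) = (var 0 - var r) # differences (map var [0..<r])"
    using assms by (simp add: upt_rec[of 0] del: upt_Suc)
  ultimately have "- ubar r # vars 1 (r - 1) = map h (differences (map var (r # [0..<r])))"
    using *[of s] s by simp
  then show ?thesis
    by (rule that[OF h(1) *])
qed

text \<open>
  Put \<open>u\<^sub>i = c\<^sub>i - c\<^bsub>i-1\<^esub>\<close>. Then push-invariance is invariance under rotating \<open>(c\<^sub>0, \<dots>, c\<^sub>r)\<close>.
\<close>

definition cyc :: "mould \<Rightarrow> nat list \<Rightarrow> ratfun" where
  "cyc M c = mould_at M (differences (map var c))"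

context
  fixes M :: mould and r :: nat
  assumes M: "M r \<in> ratfuns r" and r: "r \<ge> 1"
begin

lemma mould_at_hom_cyc:
  assumes "distinct c" "length c = Suc r" "ratfun_hom h"
  shows "mould_at M (map h (differences (map var c))) = h (cyc M c)"
  unfolding cyc_def using assms M by (intro mould_at_hom generic_differences) auto

lemma cyc_rename:
  assumes "ratfun_hom h" "\<And>i. h (var i) = var (\<pi> i)" "distinct c" "length c = Suc r"
  shows "cyc M (map \<pi> c) = h (cyc M c)"
  unfolding mould_at_hom_cyc[OF assms(3,4,1), symmetric] differences_hom[OF assms(1), symmetric]
  by (simp add: cyc_def assms(2) comp_def)

text \<open>Renaming acts on the whole sum as an injective endomorphism: single values may change,
  but vanishing does not.\<close>

lemma sum_cyc_rename:
  assumes "inj \<pi>" "\<And>i. i \<in> I \<Longrightarrow> distinct (c i) \<and> length (c i) = Suc r"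
  shows "(\<Sum>i\<in>I. cyc M (map \<pi> (c i))) = 0 \<longleftrightarrow> (\<Sum>i\<in>I. cyc M (c i)) = 0"
proof -
  obtain h where h: "ratfun_hom h" "\<And>i. h (var i) = var (\<pi> i)"
    using ratfun_hom_rename[OF assms(1)] by blast
  interpret ratfun_hom h by fact
  have "(\<Sum>i\<in>I. cyc M (map \<pi> (c i))) = h (\<Sum>i\<in>I. cyc M (c i))"
    using assms(2) by (simp add: sum cyc_rename[OF h])
  then show ?thesis by simp
qed

section \<open>The swap and the first alternality relation\<close>

lemma mould_at_swap:
  assumes "distinct c" "length c = r" "0 \<notin> set c"
    and "ratfun_hom h" "h (var 0) = var 0" "\<And>i. i \<noteq> 0 \<Longrightarrow> h (var i) = var i + var 0"
  shows "mould_at (swap M) (map var c) = h (cyc M (0 # rev c))"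
proof -
  \<comment> \<open>The leading 0 is not a variable. Adding \<open>var 0\<close> throughout
    preserves differences and gives the image under \<open>h\<close> of a list of variables.\<close>
  have eq: "differences (0 # rev (map var c)) = map h (differences (map var (0 # rev c)))"
    if "0 \<notin> set c" for c
  proof -
    have "map (\<lambda>x. x + var 0) (0 # rev (map var c)) = map h (map var (0 # rev c))"
      using that assms(5) by (auto simp: rev_map) (metis assms(6))
    then show ?thesis
      by (metis differences_shift differences_hom[OF assms(4)])
  qed
  have swap_eq: "swap M r = mould_at M (differences (0 # rev (vars 1 r)))"
  proof -
    have "differences (var n # rev (map var [1..<n])) = map (\<lambda>j. var j - var (j + 1)) (rev [1..<n])" for n
    proof (induction n)
      case (Suc n)
      then show ?case by (cases "n = 0") simp_all
    qed simp
    then show ?thesis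
      using r by (simp add: swap_def vars_def del: upt_Suc) (simp add: upt_Suc)
  qed
  have zero_notin: "0 \<notin> set [1..<Suc r]"
    by simp
  have len: "length (differences (0 # rev (vars 1 r))) = r"
    by simp
  have gen: "generic (differences (0 # rev (vars 1 r)))"
    unfolding vars_def eq[OF zero_notin]
    by (intro generic_map generic_differences assms(4)) auto
  \<comment> \<open>Required before \<open>swap M\<close> can be evaluated through the endomorphism
    \<open>k\<close>.\<close>
  have swap_in: "swap M r \<in> ratfuns r"
    unfolding swap_eq
  proof (rule mould_at_ratfuns[OF gen])
    have "0 \<in> ratfuns r"
      using to_fract_ratfuns[OF zero_polys] by simp
    then show "set (differences (0 # rev (vars 1 r))) \<subseteq> ratfuns r"
      by (intro set_differences) (auto simp: vars_def intro: var_ratfuns)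
  qed (use M len in simp)
  have "generic (map var c)"
    using assms by (intro generic_vars)
  then obtain k where k: "ratfun_hom k" "map var c = map k (vars 1 r)"
    using assms(2) unfolding generic_def by auto
  interpret k: ratfun_hom k by fact
  have "mould_at (swap M) (map var c) = k (swap M r)"
    using mould_at_hom_vars[where A = "swap M", OF swap_in k(1)] k(2) by simp
  also have "\<dots> = mould_at M (map k (differences (0 # rev (vars 1 r))))"
    unfolding swap_eq using mould_at_hom[OF gen _ k(1), of M] M len by simp
  also have "map k (differences (0 # rev (vars 1 r))) = differences (0 # rev (map var c))"
    by (simp add: k(2) rev_map flip: differences_hom[OF k(1)])
  also have "mould_at M \<dots> = h (cyc M (0 # rev c))"
    using assms by (simp add: eq mould_at_hom_cyc del: list.map)
  finally show ?thesis .
qed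

text \<open>The swap reverses each word with 1 inserted; relabelling 2, ..., r backwards restores
  the order of the other letters.\<close>

lemma first_alternality_iff:
  assumes "r \<ge> 2"
  shows "mould_sh (swap M) [var 1] (vars 2 r) = 0 \<longleftrightarrow>
    (\<Sum>i<r. cyc M (0 # take i [2..<Suc r] @ 1 # drop i [2..<Suc r])) = 0"
proof -
  define ys where "ys = [2..<Suc r]"
  have ys: "distinct ys" "length ys = r - 1" "0 \<notin> set ys" "1 \<notin> set ys"
    unfolding ys_def by auto
  obtain h where h: "ratfun_hom h" "h (var 0) = var 0" "\<And>i. i \<noteq> 0 \<Longrightarrow> h (var i) = var i + var 0"
    using ratfun_hom_shift by blast
  interpret ratfun_hom h by fact
  let ?ins = "\<lambda>i. take i ys @ 1 # drop i ys"
  have ins: "distinct (?ins i)" "0 \<notin> set (?ins i)" "length (?ins i) = r" for i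
    using ys assms by (auto dest: in_set_takeD in_set_dropD simp: set_take_disj_set_drop_if_distinct)
  have vars: "vars 2 r = map var ys"
    by (simp add: vars_def ys_def)
  have "inj var"
    by (simp add: inj_def var_eq_iff)
  have shuffles: "shuffles [var 1] (vars 2 r) = (\<lambda>i. map var (?ins i)) ` {..<r}"
    unfolding shuffles_singleton vars using ys assms
    by (intro image_cong) (auto simp: take_map drop_map)
  \<comment> \<open>\<open>mould_sh\<close> sums over a set, so different positions must give
    different words; the prefix before 1 recovers the position.\<close>
  have inj: "inj_on (\<lambda>i. map var (?ins i)) {..<r}"
  proof (rule inj_onI)
    fix i j
    assume ij: "i \<in> {..<r}" "j \<in> {..<r}" "map var (?ins i) = map var (?ins j)"
    have index: "length (takeWhile (\<lambda>x. x \<noteq> 1) (?ins i)) = i" if "i < r" for i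
      using that ys by (subst takeWhile_append2) (auto dest: in_set_takeD)
    have "?ins i = ?ins j"
      using ij(3) \<open>inj var\<close> by (meson inj_map_eq_map)
    then have "length (takeWhile (\<lambda>x. x \<noteq> 1) (?ins i)) = length (takeWhile (\<lambda>x. x \<noteq> 1) (?ins j))"
      by (rule arg_cong)
    then show "i = j"
      unfolding index[OF ij(1)[unfolded lessThan_iff]] index[OF ij(2)[unfolded lessThan_iff]] .
  qed
  define \<pi> where "\<pi> i = (if 2 \<le> i \<and> i \<le> r then r + 2 - i else i)" for i
  have "inj \<pi>"
    by (rule injI) (auto simp: \<pi>_def split: if_splits)
  have rev: "rev ys = map \<pi> ys"
    by (rule nth_equalityI) (auto simp: ys_def rev_nth \<pi>_def simp del: upt_Suc)
  have "mould_sh (swap M) [var 1] (vars 2 r) = (\<Sum>i<r. mould_at (swap M) (map var (?ins i)))"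
    unfolding mould_sh_def shuffles sum.reindex[OF inj] comp_def ..
  \<comment> \<open>Reversal turns the insertion position \<open>i\<close> into
    \<open>r - Suc i\<close>, since \<open>ys\<close> has \<open>r - 1\<close> entries.\<close>
  also have "\<dots> = (\<Sum>i<r. h (cyc M (map \<pi> (0 # take (r - Suc i) ys @ 1 # drop (r - Suc i) ys))))"
  proof (rule sum.cong[OF refl])
    fix i assume "i \<in> {..<r}"
    have "mould_at (swap M) (map var (?ins i)) = h (cyc M (0 # rev (?ins i)))"
      using ins h by (intro mould_at_swap) auto
    also have "0 # rev (?ins i) = map \<pi> (0 # take (r - Suc i) ys @ 1 # drop (r - Suc i) ys)"
      using ys(2) by (simp add: rev_take rev_drop rev take_map drop_map) (simp add: \<pi>_def)
    finally show "mould_at (swap M) (map var (?ins i)) = h (cyc M \<dots>)" .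
  qed
  also have "\<dots> = h (\<Sum>i<r. cyc M (map \<pi> (0 # take i ys @ 1 # drop i ys)))"
    unfolding sum by (rule sum.nat_diff_reindex)
  also have "\<dots> = 0 \<longleftrightarrow> (\<Sum>i<r. cyc M (0 # ?ins i)) = 0"
    unfolding eq_0_iff using ins by (intro sum_cyc_rename \<open>inj \<pi>\<close>) auto
  finally show ?thesis
    by (simp only: ys_def)
qed

text \<open>The factor \<open>ubar r\<close> is the sum of the arguments, which telescopes when
  these are consecutive differences.\<close>

lemma mould_at_mult_ubar:
  assumes "B r = ubar r * M r" "distinct c" "length c = Suc r" "ratfun_hom h"
  shows "mould_at B (map h (differences (map var c))) = h ((var (last c) - var (hd c)) * cyc M c)"
proof -
  let ?d = "differences (map var c)"
  have gen: "generic ?d" and len: "length ?d = r"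
    using assms(2,3) by (auto intro!: generic_differences)
  then obtain k where k: "ratfun_hom k" "?d = map k (vars 1 r)"
    unfolding generic_def by auto
  interpret k: ratfun_hom k by fact
  have ubar: "ubar r = sum_list (vars 1 r)"
    unfolding ubar_def vars_def by (simp add: interv_sum_list_conv_sum_set_nat atLeastLessThanSuc_atLeastAtMost del: upt_Suc)
  have "ubar r \<in> ratfuns r"
    unfolding ubar_def by (intro sum_ratfuns var_ratfuns)
  then have B: "B r \<in> ratfuns r"
    unfolding assms(1) using M by (rule mult_ratfuns)
  have "mould_at B (map h ?d) = h (mould_at B ?d)"
    using gen len B assms(4) by (intro mould_at_hom) auto
  also have "mould_at B ?d = k (ubar r) * k (M r)"
    unfolding k(2) mould_at_hom_vars[where A = B, OF B k(1)] assms(1) by (rule k.mult)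
  also have "k (ubar r) = sum_list ?d"
    by (simp only: ubar k.sum_list k(2))
  also have "\<dots> = var (last c) - var (hd c)"
    using assms(3) by (cases "c = []") (simp_all add: sum_list_differences last_map hd_map)
  also have "k (M r) = cyc M c"
    unfolding cyc_def k(2) by (rule mould_at_hom_vars[where A = M, OF M k(1), symmetric])
  finally show ?thesis .
qed

section \<open>Consequences of push-invariance: circ-neutrality and the Fay relations\<close>

context
  assumes push: "mould_at M (- ubar r # vars 1 (r - 1)) = mould_at M (vars 1 r)"
begin

text \<open>Push-invariance gives the case \<open>r # [0..<r]\<close> once an injective endomorphism
  is cancelled; renaming transfers it to all distinct lists.\<close>

lemma cyc_rotate1:
  assumes "distinct (a # c)" "length c = r"
  shows "cyc M (a # c) = cyc M (c @ [a])"
proof -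
  obtain h where h: "ratfun_hom h"
    "vars 1 r = map h (differences (map var [0..<Suc r]))"
    "- ubar r # vars 1 (r - 1) = map h (differences (map var (r # [0..<r])))"
    using r by (rule push_arguments_eq_differences)
  interpret ratfun_hom h by fact
  have "h (cyc M (r # [0..<r])) = h (cyc M [0..<Suc r])"
    using push unfolding h(2,3) by (subst (asm) (1 2) mould_at_hom_cyc) (simp_all add: h(1))
  then have *: "cyc M (r # [0..<r]) = cyc M [0..<Suc r]"
    by (simp add: eq_iff)
  \<comment> \<open>Built from \<open>c @ [a]\<close>, so that \<open>r\<close> goes to
    \<open>a\<close> and \<open>[0..<r]\<close> to \<open>c\<close>.\<close>
  obtain \<pi> where \<pi>: "inj \<pi>" "c @ [a] = map \<pi> [0..<length (c @ [a])]"
    using assms by (metis distinct.simps(2) distinct1_rotate extend_inj rotate1.simps(2))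
  obtain k where k: "ratfun_hom k" "\<And>i. k (var i) = var (\<pi> i)"
    using ratfun_hom_rename[OF \<pi>(1)] by blast
  have "c @ [a] = map \<pi> [0..<Suc r]" "a # c = map \<pi> (r # [0..<r])"
    using \<pi>(2) assms(2) by simp_all
  then show ?thesis
    using * by (simp add: cyc_rename[OF k] del: upt_Suc list.map)
qed

lemma cyc_rotate:
  assumes "distinct (xs @ ys)" "length (xs @ ys) = Suc r"
  shows "cyc M (xs @ ys) = cyc M (ys @ xs)"
  using assms
proof (induction xs arbitrary: ys)
  case (Cons x xs)
  have "cyc M (x # (xs @ ys)) = cyc M ((xs @ ys) @ [x])"
    using Cons.prems by (intro cyc_rotate1) auto
  also have "\<dots> = cyc M (xs @ (ys @ [x]))"
    by simp
  also have "\<dots> = cyc M ((ys @ [x]) @ xs)"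
    using Cons.prems by (intro Cons.IH) auto
  finally show ?case by simp
qed simp


lemma circ_neutral_iff:
  assumes "r \<ge> 2"
  shows "(\<Sum>k<r. mould_at (swap M) (rotate k (vars 1 r))) = 0 \<longleftrightarrow>
    (\<Sum>i<r. cyc M (0 # take i [2..<Suc r] @ 1 # drop i [2..<Suc r])) = 0"
proof -
  define xs where "xs = [1..<Suc r]"
  define ys where "ys = [2..<Suc r]"
  have xs: "distinct xs" "length xs = r" "0 \<notin> set xs"
    unfolding xs_def by auto
  have vars: "vars 1 r = map var xs"
    by (simp add: vars_def xs_def)
  have xs_ys: "xs = 1 # ys"
    using assms unfolding xs_def ys_def by (subst upt_rec) (simp add: numeral_2_eq_2 del: upt_Suc)
  obtain h where h: "ratfun_hom h" "h (var 0) = var 0" "\<And>i. i \<noteq> 0 \<Longrightarrow> h (var i) = var i + var 0"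
    using ratfun_hom_shift by blast
  interpret ratfun_hom h by fact
  have rot: "distinct (0 # drop i ys @ 1 # take i ys) \<and> length (0 # drop i ys @ 1 # take i ys) = Suc r" for i
    using xs set_take_disj_set_drop_if_distinct[of ys i i] unfolding xs_ys
    by (auto dest: in_set_takeD in_set_dropD)
  \<comment> \<open>Undoes the reversal by the swap; here the label 1 is moved as well.\<close>
  define \<pi> where "\<pi> i = (if 1 \<le> i \<and> i \<le> r then r + 1 - i else i)" for i
  have "inj \<pi>"
    by (rule injI) (auto simp: \<pi>_def split: if_splits)
  have rev: "rev xs = map \<pi> xs"
    by (rule nth_equalityI) (auto simp: xs_def rev_nth \<pi>_def simp del: upt_Suc)
  \<comment> \<open>Circ-neutrality inserts 0 where first alternality inserts 1, so these labels are
    exchanged.\<close>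
  define \<rho> :: "nat \<Rightarrow> nat" where "\<rho> i = (if i = 0 then 1 else if i = 1 then 0 else i)" for i
  have "inj \<rho>"
    by (rule injI) (auto simp: \<rho>_def split: if_splits)
  have \<rho>_ys: "map \<rho> ys = ys"
    by (rule map_idI) (auto simp: \<rho>_def ys_def)
  have "(\<Sum>k<r. mould_at (swap M) (rotate k (vars 1 r))) =
      (\<Sum>k<r. h (cyc M (map \<pi> (0 # drop (r - Suc k) ys @ 1 # take (r - Suc k) ys))))"
  proof (rule sum.cong[OF refl])
    fix k assume k: "k \<in> {..<r}"
    have "mould_at (swap M) (map var (rotate k xs)) = h (cyc M (0 # rev (rotate k xs)))"
      using xs h by (intro mould_at_swap) auto
    also have "0 # rev (rotate k xs) = map \<pi> (0 # drop (r - k) xs @ take (r - k) xs)"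
      using k xs(2) by (simp add: rotate_drop_take rev_take rev_drop rev take_map drop_map) (simp add: \<pi>_def)
    \<comment> \<open>As \<open>k < r\<close>, the taken part is nonempty and contains the head 1 of
      \<open>xs\<close>.\<close>
    also have "r - k = Suc (r - Suc k)"
      using k by auto
    finally show "mould_at (swap M) (rotate k (vars 1 r)) =
        h (cyc M (map \<pi> (0 # drop (r - Suc k) ys @ 1 # take (r - Suc k) ys)))"
      unfolding vars rotate_map by (simp add: xs_ys)
  qed
  also have "\<dots> = h (\<Sum>i<r. cyc M (map \<pi> (0 # drop i ys @ 1 # take i ys)))"
    unfolding sum by (rule sum.nat_diff_reindex)
  also have "\<dots> = 0 \<longleftrightarrow> (\<Sum>i<r. cyc M (0 # drop i ys @ 1 # take i ys)) = 0"
    unfolding eq_0_iff using rot by (intro sum_cyc_rename \<open>inj \<pi>\<close>) auto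
  also have "\<dots> \<longleftrightarrow> (\<Sum>i<r. cyc M (map \<rho> (0 # drop i ys @ 1 # take i ys))) = 0"
    using rot by (intro sum_cyc_rename[symmetric] \<open>inj \<rho>\<close>) auto
  also have "(\<lambda>i. cyc M (map \<rho> (0 # drop i ys @ 1 # take i ys))) = (\<lambda>i. cyc M (0 # take i ys @ 1 # drop i ys))"
  proof
    fix i
    have "map \<rho> (0 # drop i ys @ 1 # take i ys) = (1 # drop i ys) @ (0 # take i ys)"
      by (simp add: \<rho>_ys flip: take_map drop_map) (simp add: \<rho>_def)
    \<comment> \<open>Rotation brings 0 back to the front; this is where push-invariance
      enters.\<close>
    also have "cyc M \<dots> = cyc M ((0 # take i ys) @ (1 # drop i ys))"
      using rot[of i] by (intro cyc_rotate) auto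
    finally show "cyc M (map \<rho> (0 # drop i ys @ 1 # take i ys)) = cyc M (0 # take i ys @ 1 # drop i ys)"
      by simp
  qed
  finally show ?thesis
    by (simp only: ys_def)
qed

lemma Fay_iff:
  assumes "B r = ubar r * M r" "r \<ge> 2"
  shows "Fay B r = 0 \<longleftrightarrow> (\<Sum>i<r. cyc M (0 # take i [2..<Suc r] @ 1 # drop i [2..<Suc r])) = 0"
proof -
  obtain h where h: "ratfun_hom h" "h (var 0) = var 0" "h (var 1) = var 0 - var 1"
    "\<And>i. i \<ge> 2 \<Longrightarrow> h (var i) = var 0 + (\<Sum>j = 2..i. var j)"
    using ratfun_hom_Fay by blast
  interpret ratfun_hom h by fact
  \<comment> \<open>For \<open>i \<ge> 2\<close> this is \<open>h (var i)\<close>, and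
    \<open>s 1 = h (var 0)\<close>: index 1 stands for the entry 0, so 0, 2, ..., r have the images
    \<open>s 1\<close>, ..., \<open>s r\<close>.\<close>
  define s where "s i = var 0 + (\<Sum>j = 2..i. var j)" for i
  have s1: "s (Suc 0) = var 0"
    by (simp add: s_def)
  have map_s: "map (\<lambda>i. h (var i)) [a..<b] = map s [a..<b]" if "a \<ge> 2" for a b
    using that by (simp add: h(4) s_def)
  have vars_s: "differences (map s [a..<Suc b]) = vars (Suc a) b" if "a \<ge> 1" for a b
    using that
    by (intro nth_equalityI) (auto simp: nth_differences vars_def s_def simp del: upt_Suc)
  \<comment> \<open>As \<open>var 0 - var 1\<close> is the image of \<open>var 1\<close>, its
    neighbouring differences are the Fay arguments \<open>- ubar i\<close> and
    \<open>ubar (i + 1)\<close>.\<close>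
  have s_ubar: "s i - (var 0 - var 1) = ubar i" if "i \<ge> 1" for i
    using that by (simp add: s_def ubar_def sum.atLeast_Suc_atMost numeral_2_eq_2)
  have s_upt: "var 0 # map s [2..<b] = map s [1..<b]" if "b \<ge> 2" for b
    using that by (simp add: upt_conv_Cons[of "Suc 0"] s1 numeral_2_eq_2)
  have snoc: "differences (var 0 # map s [2..<Suc i] @ [var 0 - var 1]) = vars 2 i @ [- ubar i]"
    if "i \<ge> 1" for i
  proof -
    have eq: "var 0 # map s [2..<Suc i] @ [var 0 - var 1] = map s [1..<i] @ s i # [var 0 - var 1]"
      using that s_upt[of "Suc i"] by simp
    have "differences (var 0 # map s [2..<Suc i] @ [var 0 - var 1]) =
        differences (map s [1..<Suc i]) @ [var 0 - var 1 - s i]"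
      by (subst eq, subst differences_append) (use that in simp)
    also have "var 0 - var 1 - s i = - ubar i"
      using s_ubar[OF that] by (simp add: algebra_simps)
    also have "differences (map s [1..<Suc i]) = vars 2 i"
      using vars_s[of 1 i] by (simp add: numeral_2_eq_2)
    finally show ?thesis .
  qed
  have dist: "distinct (0 # [2..<Suc i] @ 1 # [Suc i..<Suc r])"
    "length (0 # [2..<Suc i] @ 1 # [Suc i..<Suc r]) = Suc r" if "1 \<le> i" "i \<le> r" for i
    using that by auto
  \<comment> \<open>The entry 1 follows \<open>i\<close>, or follows 0 if \<open>i = 1\<close>; for
    \<open>i = r\<close> it is last.\<close>
  let ?c = "\<lambda>i. cyc M (0 # [2..<Suc i] @ 1 # [Suc i..<Suc r])"
  \<comment> \<open>For \<open>i < r\<close> the word still runs from 0 to \<open>r\<close>, which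
    gives the factor \<open>var r - var 0\<close>.\<close>
  have middle: "mould_at B (vars 2 i @ [- ubar i, ubar (i + 1)] @ vars (i + 2) r) = h ((var r - var 0) * ?c i)"
    if i: "i \<in> {1..r - 1}" for i
  proof -
    have "map h (differences (map var (0 # [2..<Suc i] @ 1 # [Suc i..<Suc r]))) =
        differences ((var 0 # map s [2..<Suc i]) @ (var 0 - var 1) # map s [Suc i..<Suc r])"
      using i h(2,3)
      by (simp add: map_s comp_def del: upt_Suc flip: differences_hom[OF h(1)])
    also have "\<dots> = (vars 2 i @ [- ubar i]) @ differences ((var 0 - var 1) # map s [Suc i..<Suc r])"
      using snoc[of i] i by (subst differences_append) simp
    also have "differences ((var 0 - var 1) # map s [Suc i..<Suc r]) =
        (s (Suc i) - (var 0 - var 1)) # differences (map s [Suc i..<Suc r])"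
      using i by (subst (1 2) upt_rec) auto
    also have "\<dots> = ubar (i + 1) # vars (i + 2) r"
      using i s_ubar[of "Suc i"] vars_s[of "Suc i" r] by simp
    finally show ?thesis
      using mould_at_mult_ubar[where B = B, OF assms(1) dist[of i] h(1)] i by auto
  qed
  have "map h (differences (map var (0 # [2..<Suc r] @ 1 # [Suc r..<Suc r]))) = vars 2 r @ [- ubar r]"
    using snoc[of r] h(2,3) r
    by (simp add: map_s comp_def del: upt_Suc flip: differences_hom[OF h(1)])
  then have second: "mould_at B (vars 2 r @ [- ubar r]) = h ((var 1 - var 0) * ?c r)"
    using mould_at_mult_ubar[where B = B, OF assms(1) dist[of r] h(1)] r by simp
  have "map h (differences (map var (1 # 0 # [2..<Suc r]))) = differences ((var 0 - var 1) # map s [1..<Suc r])"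
    using h(2,3) s_upt[of "Suc r"] assms(2)
    by (simp add: map_s comp_def del: upt_Suc differences.simps flip: differences_hom[OF h(1)])
  also have "\<dots> = (s 1 - (var 0 - var 1)) # differences (map s [1..<Suc r])"
    using r by (subst (1 2) upt_rec) auto
  also have "\<dots> = vars 1 r"
    using vars_s[of 1 r] s1 r by (simp add: vars_def upt_rec[of "Suc 0" "Suc r"] del: upt_Suc)
  finally have "mould_at B (vars 1 r) = h ((var r - var 1) * cyc M (1 # 0 # [2..<Suc r]))"
    using mould_at_mult_ubar[where B = B, OF assms(1) _ _ h(1), of "1 # 0 # [2..<Suc r]"] assms(2) by simp
  \<comment> \<open>Rotation moves the leading 1 to the end, so the first two Fay terms share one
    value of \<open>cyc\<close>.\<close>
  also have "cyc M (1 # 0 # [2..<Suc r]) = ?c r"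
    using r cyc_rotate[of "[1]" "0 # [2..<Suc r]"] by (simp del: upt_Suc)
  finally have first: "mould_at B (vars 1 r) = h ((var r - var 1) * ?c r)" .
  have rest: "(\<Sum>i = 1..r - 1. mould_at B (vars 2 i @ [- ubar i, ubar (i + 1)] @ vars (i + 2) r)) =
      h ((var r - var 0) * (\<Sum>i = 1..r - 1. ?c i))"
    unfolding sum_distrib_left sum by (intro sum.cong refl middle)
  \<comment> \<open>The factors \<open>var r - var 1\<close> and \<open>var 1 - var 0\<close> add up
    to the common one, so the first two terms supply the summand \<open>i = r\<close>.\<close>
  have "Fay B r = h ((var r - var 0) * (?c r + (\<Sum>i = 1..r - 1. ?c i)))"
    unfolding Fay_def first second rest add[symmetric]
    by (rule arg_cong[where f = h]) (simp add: algebra_simps del: upt_Suc)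
  also have "?c r + (\<Sum>i = 1..r - 1. ?c i) = (\<Sum>i = 1..r. ?c i)"
    using r by (cases r) (simp_all add: add.commute)
  also have "\<dots> = (\<Sum>i<r. ?c (Suc i))"
    by (simp add: sum.atLeast1_atMost_eq del: upt_Suc)
  also have "\<dots> = (\<Sum>i<r. cyc M (0 # take i [2..<Suc r] @ 1 # drop i [2..<Suc r]))"
    by (intro sum.cong refl arg_cong[where f = "cyc M"]) (simp del: upt_Suc)
  \<comment> \<open>The factor cancels because \<open>h\<close> is injective and
    \<open>var r\<close> differs from \<open>var 0\<close>.\<close>
  finally show ?thesis
    using assms(2) by (simp add: var_eq_iff)
qed

end

end

theorem theorem1p2:
  fixes M A A' :: mould
  assumes "M \<in> ARI_Delta"
    and "alternal M"
    and "push_invariant M"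
    and "A = Delta M"
    and "A' = div_vars A"
  shows "((\<forall>r \<ge> 2. Fay A' r = 0) \<longleftrightarrow> first_alternality (swap M)) \<and>
         (first_alternality (swap M) \<longleftrightarrow> circ_neutral (swap M))"
proof -
  have M: "M r \<in> ratfuns r" for r
    using assms(1) by (simp add: ARI_Delta_def ARI_def is_mould_def)
  have push: "mould_at M (- ubar r # vars 1 (r - 1)) = mould_at M (vars 1 r)" if "r \<ge> 1" for r
    using assms(3) that by (simp add: push_invariant_def)
  have A': "A' r = ubar r * M r" if "r \<ge> 1" for r
    using that by (simp add: assms(4,5) div_vars_Delta)
  have "Fay A' r = 0 \<longleftrightarrow> mould_sh (swap M) [var 1] (vars 2 r) = 0"
    "mould_sh (swap M) [var 1] (vars 2 r) = 0 \<longleftrightarrow> (\<Sum>k<r. mould_at (swap M) (rotate k (vars 1 r))) = 0"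
    if r: "r \<ge> 2" for r
  proof -
    have r1: "r \<ge> 1"
      using r by simp
    \<comment> \<open>All three equivalences have the same right-hand side, the sum over insertions
      of 1 into 0, 2, ..., r.\<close>
    note iffs = Fay_iff[where B = A' and M = M, OF M r1 push[OF r1] A'[OF r1] r]
      first_alternality_iff[where M = M, OF M r1 r]
      circ_neutral_iff[where M = M, OF M r1 push[OF r1] r]
    show "Fay A' r = 0 \<longleftrightarrow> mould_sh (swap M) [var 1] (vars 2 r) = 0"
      "mould_sh (swap M) [var 1] (vars 2 r) = 0 \<longleftrightarrow> (\<Sum>k<r. mould_at (swap M) (rotate k (vars 1 r))) = 0"
      unfolding iffs by simp_all
  qed
  then show ?thesis
    unfolding first_alternality_def circ_neutral_def by blast
qed

end
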